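(* Let $n\ge 0$ be an integer, and let $V(n)$ be the $(n+1)$-dimensional simple module of the complex Lie algebra $\mathfrak{sl}(2)$. Then $$\mathrm{Bder}(\mathfrak{sl}(2),V(n))=\begin{cases}\mathrm{Ibder}(\mathfrak{sl}(2)) & \text{if } n=2,\\ 0 & \text{if } n\neq 2.\end{cases}$$
   Context: All Lie algebras and modules are finite-dimensional over $\mathbb{C}$. For a Lie algebra $L$ and an $L$-module $V$, a biderivation of $L$ on $V$ is a bilinear map $g:L\times L\to V$ (no skew-symmetry is assumed) such that for all $x,y,z\in L$: $g([x,y],z)=xg(y,z)-yg(x,z)$ and $g(x,[y,z])=yg(x,z)-zg(x,y)$. The set of biderivations of $L$ on $V$ is denoted $\mathrm{Bder}(L,V)$. $\mathfrak{sl}(2)$ is the 3-dimensional complex simple Lie algebra of traceless $2\times 2$ matrices with standard basis $e=\begin{pmatrix}0&1\\0&0\end{pmatrix}$, $h=\begin{pmatrix}1&0\\0&-1\end{pmatrix}$, $f=\begin{pmatrix}0&0\\1&0\end{pmatrix}$. The simple module $V(n)$ has basis $v_0,v_1,\ldots,v_n$ with action $ev_i=i(n+1-i)v_{i-1}$, $hv_i=(n-2i)v_i$, $fv_i=v_{i+1}$ for $0\le i\le n$, where $v_{-1}=v_{n+1}=0$. The module $V(2)$ is identified with the adjoint module of $\mathfrak{sl}(2)$ via the $\mathfrak{sl}(2)$-module isomorphism sending $v_0$ to $e$. Under this identification, for each $\lambda\in\mathbb{C}$ the map $\mathfrak{sl}(2)\times\mathfrak{sl}(2)\to V(2)$, $(x,y)\mapsto\lambda[x,y]$,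 is a biderivation, called inner; $\mathrm{Ibder}(\mathfrak{sl}(2))$ denotes the set of all these inner biderivations (over all $\lambda\in\mathbb{C}$). *)

theory Defs
  imports "HOL-Analysis.Analysis" "HOL-Library.Function_Algebras"
begin

section \<open>Lie algebras, Lie modules and biderivations\<close>

text \<open>Complex Lie algebras and their modules live on subspaces \<open>L\<close> and \<open>V\<close> of ambient complex vector
  spaces. The axioms and all definitions only constrain the values on these subspaces.\<close>

definition bilinear_on ::
  "(complex \<Rightarrow> 'a \<Rightarrow> 'a) \<Rightarrow> 'a set \<Rightarrow> (complex \<Rightarrow> 'b \<Rightarrow> 'b) \<Rightarrow> 'b set \<Rightarrow> (complex \<Rightarrow> 'c \<Rightarrow> 'c) \<Rightarrow>
   ('a::ab_group_add \<Rightarrow> 'b::ab_group_add \<Rightarrow> 'c::ab_group_add) \<Rightarrow> bool" where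
  "bilinear_on sA A sB B sC g \<longleftrightarrow>
     (\<forall>x\<in>A. \<forall>x'\<in>A. \<forall>y\<in>B. g (x + x') y = g x y + g x' y) \<and>
     (\<forall>c. \<forall>x\<in>A. \<forall>y\<in>B. g (sA c x) y = sC c (g x y)) \<and>
     (\<forall>x\<in>A. \<forall>y\<in>B. \<forall>y'\<in>B. g x (y + y') = g x y + g x y') \<and>
     (\<forall>c. \<forall>x\<in>A. \<forall>y\<in>B. g x (sB c y) = sC c (g x y))"

locale lie_algebra = L: vector_space scaleL
  for scaleL :: "complex \<Rightarrow> 'a::ab_group_add \<Rightarrow> 'a" +
  fixes L :: "'a set" and bracket :: "'a \<Rightarrow> 'a \<Rightarrow> 'a"
  assumes subspace_L: "L.subspace L"
    and bracket_closed: "x \<in> L \<Longrightarrow> y \<in> L \<Longrightarrow> bracket x y \<in> L"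
    and bracket_bilinear: "bilinear_on scaleL L scaleL L scaleL bracket"
    and bracket_alternating: "x \<in> L \<Longrightarrow> bracket x x = 0"
    and jacobi: "x \<in> L \<Longrightarrow> y \<in> L \<Longrightarrow> z \<in> L \<Longrightarrow>
      bracket x (bracket y z) + bracket y (bracket z x) + bracket z (bracket x y) = 0"

locale lie_module = lie_algebra scaleL L bracket + V: vector_space scaleV
  for scaleL :: "complex \<Rightarrow> 'a::ab_group_add \<Rightarrow> 'a" and L bracket
    and scaleV :: "complex \<Rightarrow> 'v::ab_group_add \<Rightarrow> 'v" +
  fixes V :: "'v set" and act :: "'a \<Rightarrow> 'v \<Rightarrow> 'v"
  assumes subspace_V: "V.subspace V"
    and act_closed: "x \<in> L \<Longrightarrow> v \<in> V \<Longrightarrow> act x v \<in> V"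
    and act_bilinear: "bilinear_on scaleL L scaleV V scaleV act"
    and act_bracket: "x \<in> L \<Longrightarrow> y \<in> L \<Longrightarrow> v \<in> V \<Longrightarrow>
      act (bracket x y) v = act x (act y v) - act y (act x v)"
begin

text \<open>Maps on \<open>L \<times> L\<close> are curried and extensional, so that equality of elements of \<open>Bder\<close> is
  equality of maps on \<open>L \<times> L\<close>.\<close>

definition Bder :: "('a \<Rightarrow> 'a \<Rightarrow> 'v) set" where
  "Bder = {g \<in> L \<rightarrow>\<^sub>E (L \<rightarrow>\<^sub>E V).
     bilinear_on scaleL L scaleL L scaleV g \<and>
     (\<forall>x\<in>L. \<forall>y\<in>L. \<forall>z\<in>L. g (bracket x y) z = act x (g y z) - act y (g x z)) \<and>
     (\<forall>x\<in>L. \<forall>y\<in>L. \<forall>z\<in>L. g x (bracket y z) = act y (g x z) - act z (g x y))}"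

end

definition lie_module_iso ::
  "'a set \<Rightarrow> (complex \<Rightarrow> 'v \<Rightarrow> 'v) \<Rightarrow> 'v set \<Rightarrow> ('a \<Rightarrow> 'v \<Rightarrow> 'v) \<Rightarrow>
   (complex \<Rightarrow> 'w \<Rightarrow> 'w) \<Rightarrow> 'w set \<Rightarrow> ('a \<Rightarrow> 'w \<Rightarrow> 'w) \<Rightarrow>
   ('v::ab_group_add \<Rightarrow> 'w::ab_group_add) \<Rightarrow> bool" where
  "lie_module_iso L sV V actV sW W actW \<phi> \<longleftrightarrow>
     bij_betw \<phi> V W \<and>
     (\<forall>v\<in>V. \<forall>w\<in>V. \<phi> (v + w) = \<phi> v + \<phi> w) \<and>
     (\<forall>c. \<forall>v\<in>V. \<phi> (sV c v) = sW c (\<phi> v)) \<and>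
     (\<forall>x\<in>L. \<forall>v\<in>V. \<phi> (actV x v) = actW x (\<phi> v))"


section \<open>The Lie algebra sl(2)\<close>

definition mscale :: "complex \<Rightarrow> complex^2^2 \<Rightarrow> complex^2^2" where
  "mscale c A = (\<chi> i j. c * A $ i $ j)"

definition sl2 :: "(complex^2^2) set" where
  "sl2 = {A. trace A = 0}"

definition commutator :: "complex^2^2 \<Rightarrow> complex^2^2 \<Rightarrow> complex^2^2" where
  "commutator A B = A ** B - B ** A"

definition sl2_e :: "complex^2^2" where "sl2_e = vector [vector [0, 1], vector [0, 0]]"
definition sl2_h :: "complex^2^2" where "sl2_h = vector [vector [1, 0], vector [0, -1]]"
definition sl2_f :: "complex^2^2" where "sl2_f = vector [vector [0, 0], vector [1, 0]]"

lemma sl2_iff: "A \<in> sl2 \<longleftrightarrow> A $ 2 $ 2 = - A $ 1 $ 1"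
  by (auto simp: sl2_def trace_def sum_2 add_eq_0_iff)

lemma efh_in_sl2 [simp]: "sl2_e \<in> sl2" "sl2_h \<in> sl2" "sl2_f \<in> sl2"
  by (simp_all add: sl2_iff sl2_e_def sl2_h_def sl2_f_def)

lemma sl2_decomp:
  "A \<in> sl2 \<Longrightarrow> A = mscale (A $ 1 $ 2) sl2_e + mscale (A $ 1 $ 1) sl2_h + mscale (A $ 2 $ 1) sl2_f"
  by (simp add: sl2_iff vec_eq_iff forall_2 mscale_def sl2_e_def sl2_h_def sl2_f_def)

lemmas mat2_simps = vec_eq_iff forall_2 mscale_def commutator_def matrix_matrix_mult_def sum_2

interpretation sl2: lie_algebra mscale sl2 commutator
proof -
  interpret vector_space mscale
    by unfold_locales (simp_all add: mat2_simps algebra_simps)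
  show "lie_algebra mscale sl2 commutator"
  proof
    show "subspace sl2"
      by (rule subspaceI) (auto simp: sl2_iff mscale_def)
    show "bilinear_on mscale sl2 mscale sl2 mscale commutator"
      unfolding bilinear_on_def by (simp add: mat2_simps algebra_simps)
  qed (simp_all add: sl2_iff mat2_simps algebra_simps)
qed

interpretation adj: lie_module mscale sl2 commutator mscale sl2 commutator
proof
  show "sl2.L.subspace sl2" by (rule sl2.subspace_L)
  show "bilinear_on mscale sl2 mscale sl2 mscale commutator" by (rule sl2.bracket_bilinear)
qed (simp_all add: sl2_iff mat2_simps algebra_simps)


section \<open>The modules V(n)\<close>

text \<open>A vector of \<open>V n\<close> is the sequence of its coordinates with respect to \<open>v\<^sub>0, \<dots>, v\<^sub>n\<close>.\<close>

definition vscale :: "complex \<Rightarrow> (nat \<Rightarrow> complex) \<Rightarrow> (nat \<Rightarrow> complex)" where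
  "vscale c v = (\<lambda>i. c * v i)"

definition V :: "nat \<Rightarrow> (nat \<Rightarrow> complex) set" where
  "V n = {v. \<forall>i>n. v i = 0}"

text \<open>The index is an integer, so that \<open>vb n (-1) = vb n (n + 1) = 0\<close>.\<close>

definition vb :: "nat \<Rightarrow> int \<Rightarrow> (nat \<Rightarrow> complex)" where
  "vb n k = (\<lambda>j. if int j = k \<and> j \<le> n then 1 else 0)"

text \<open>The bilinear extension of the action of \<open>e\<close>, \<open>h\<close>, \<open>f\<close> on the basis vectors; the coordinates
  of \<open>x\<close> with respect to \<open>e\<close>, \<open>h\<close>, \<open>f\<close> are its entries at (1,2), (1,1), (2,1).\<close>

definition vact :: "nat \<Rightarrow> complex^2^2 \<Rightarrow> (nat \<Rightarrow> complex) \<Rightarrow> (nat \<Rightarrow> complex)" where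
  "vact n x v = (\<Sum>i\<le>n. vscale (v i)
     (vscale (x $ 1 $ 2) (vscale (of_nat i * of_nat (n + 1 - i)) (vb n (int i - 1))) +
      vscale (x $ 1 $ 1) (vscale (of_nat n - 2 * of_nat i) (vb n (int i))) +
      vscale (x $ 2 $ 1) (vb n (int i + 1))))"

lemma sum_fun_apply: "(\<Sum>i\<in>A. F i) j = (\<Sum>i\<in>A. (F i :: 'b \<Rightarrow> 'c::comm_monoid_add) j)"
  by (induction A rule: infinite_finite_induct) auto

lemma vb_in_V [simp]: "vb n k \<in> V n"
  by (simp add: vb_def V_def)

lemma vb_outside [simp]: "vb n (-1) = 0" "vb n (int n + 1) = 0"
  by (auto simp: vb_def fun_eq_iff)

lemma V_expansion: "v \<in> V n \<Longrightarrow> v = (\<Sum>i\<le>n. vscale (v i) (vb n (int i)))"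
proof
  fix j assume "v \<in> V n"
  have "(\<Sum>i\<le>n. vscale (v i) (vb n (int i))) j = (\<Sum>i\<le>n. if i = j then v i else 0)"
    unfolding sum_fun_apply by (intro sum.cong) (auto simp: vscale_def vb_def)
  also have "\<dots> = v j"
    using \<open>v \<in> V n\<close> by (simp add: V_def)
  finally show "v j = (\<Sum>i\<le>n. vscale (v i) (vb n (int i))) j" ..
qed

lemma vact_coord:
  assumes "v \<in> V n"
  shows "vact n x v j =
    (if j \<le> n then x $ 1 $ 2 * (of_nat (j + 1) * (of_nat n - of_nat j) * v (j + 1))
        + x $ 1 $ 1 * ((of_nat n - 2 * of_nat j) * v j)
        + x $ 2 $ 1 * (if j = 0 then 0 else v (j - 1)) else 0)"
proof (cases "j \<le> n")
  case False
  then show ?thesis by (simp add: vact_def sum_fun_apply vscale_def vb_def)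
next
  case True
  have 1: "(\<Sum>i\<le>n. v i * (x $ 1 $ 2 * (of_nat i * of_nat (n + 1 - i) * vb n (int i - 1) j)))
      = x $ 1 $ 2 * (of_nat (j + 1) * (of_nat n - of_nat j) * v (j + 1))"
  proof -
    have "(\<Sum>i\<le>n. v i * (x $ 1 $ 2 * (of_nat i * of_nat (n + 1 - i) * vb n (int i - 1) j)))
      = (\<Sum>i\<le>n. if i = j + 1 then v i * (x $ 1 $ 2 * (of_nat i * of_nat (n + 1 - i))) else 0)"
      using True by (intro sum.cong) (auto simp: vb_def)
    also have "\<dots> = x $ 1 $ 2 * (of_nat (j + 1) * (of_nat n - of_nat j) * v (j + 1))"
      using assms True by (auto simp: V_def of_nat_diff)
    finally show ?thesis .
  qed
  have 2: "(\<Sum>i\<le>n. v i * (x $ 1 $ 1 * ((of_nat n - 2 * of_nat i) * vb n (int i) j)))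
      = x $ 1 $ 1 * ((of_nat n - 2 * of_nat j) * v j)"
  proof -
    have "(\<Sum>i\<le>n. v i * (x $ 1 $ 1 * ((of_nat n - 2 * of_nat i) * vb n (int i) j)))
      = (\<Sum>i\<le>n. if i = j then v i * (x $ 1 $ 1 * (of_nat n - 2 * of_nat i)) else 0)"
      using True by (intro sum.cong) (auto simp: vb_def)
    then show ?thesis using True by simp
  qed
  have 3: "(\<Sum>i\<le>n. v i * (x $ 2 $ 1 * vb n (int i + 1) j))
      = x $ 2 $ 1 * (if j = 0 then 0 else v (j - 1))"
  proof -
    have "(\<Sum>i\<le>n. v i * (x $ 2 $ 1 * vb n (int i + 1) j))
      = (\<Sum>i\<le>n. if i = j - 1 then if j = 0 then 0 else v i * x $ 2 $ 1 else 0)"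
      using True by (intro sum.cong) (auto simp: vb_def)
    then show ?thesis using True by (auto simp: le_diff_conv)
  qed
  from 1 2 3 True show ?thesis
    by (simp add: vact_def sum_fun_apply vscale_def distrib_left sum.distrib mult.assoc)
qed

lemma int_minus_one_eq: "int x = int i - 1 \<Longrightarrow> i = x + 1"
  by simp

lemma vact_basis:
  assumes "i \<le> n"
  shows "vact n sl2_e (vb n (int i)) = vscale (of_nat (i * (n + 1 - i))) (vb n (int i - 1))"
    and "vact n sl2_h (vb n (int i)) = vscale (of_nat n - 2 * of_nat i) (vb n (int i))"
    and "vact n sl2_f (vb n (int i)) = vb n (int i + 1)"
  using assms
  by (simp_all add: fun_eq_iff vact_coord sl2_e_def sl2_h_def sl2_f_def)
    (auto simp: vb_def vscale_def of_nat_diff intro: arg_cong2[where f = "(*)"]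
      dest!: int_minus_one_eq)

interpretation Vn: lie_module mscale sl2 commutator vscale "V n" "vact n" for n
proof -
  interpret vector_space vscale
    by unfold_locales (simp_all add: vscale_def fun_eq_iff algebra_simps)
  have sub: "subspace (V n)"
    by (rule subspaceI) (auto simp: V_def vscale_def)
  have closed: "vact m x v \<in> V m" if "v \<in> V m" for m x v
    using that by (simp add: V_def[of m] vact_coord)
  show "lie_module mscale sl2 commutator vscale (V n) (vact n)"
  proof
    show "bilinear_on mscale sl2 vscale (V n) vscale (vact n)"
      unfolding bilinear_on_def
      using sub by (auto simp: fun_eq_iff vact_coord subspace_add subspace_scale)
        (auto simp: vact_coord vscale_def mscale_def algebra_simps)
    fix x y v assume *: "x \<in> sl2" "y \<in> sl2" "v \<in> V n"
    show "vact n (commutator x y) v = vact n x (vact n y v) - vact n y (vact n x v)"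
    proof
      fix j
      have v0: "v (Suc n) = 0" "v (Suc (Suc n)) = 0" using * by (auto simp: V_def)
      have c: "commutator x y $ 1 $ 2 = 2 * (x $ 1 $ 1 * y $ 1 $ 2 - y $ 1 $ 1 * x $ 1 $ 2)"
        "commutator x y $ 2 $ 1 = 2 * (x $ 2 $ 1 * y $ 1 $ 1 - y $ 2 $ 1 * x $ 1 $ 1)"
        "commutator x y $ 1 $ 1 = x $ 1 $ 2 * y $ 2 $ 1 - y $ 1 $ 2 * x $ 2 $ 1"
        using * by (simp_all add: mat2_simps sl2_iff algebra_simps)
      consider "j > n" | "j \<le> n" "j = 0" | k where "j \<le> n" "j = Suc k"
        by (cases j) force+
      then show "vact n (commutator x y) v j = (vact n x (vact n y v) - vact n y (vact n x v)) j"
      proof cases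
        case 1
        then show ?thesis using * by (simp add: vact_coord closed)
      next
        case 2
        then show ?thesis using * v0
          by (cases "n = 0") (simp_all add: vact_coord closed c algebra_simps)
      next
        case 3
        then show ?thesis using * v0
          by (cases "n = j") (simp_all add: vact_coord closed c algebra_simps)
      qed
    qed
  qed (use sub closed in auto)
qed


section \<open>Inner biderivations\<close>

text \<open>The isomorphism from \<open>V 2\<close> to the adjoint module sending \<open>v\<^sub>0\<close> to \<open>e\<close>;
  its existence and uniqueness is \<open>is_V2_adj_iso_iff\<close>.\<close>

definition is_V2_adj_iso :: "((nat \<Rightarrow> complex) \<Rightarrow> complex^2^2) \<Rightarrow> bool" where
  "is_V2_adj_iso \<phi> \<longleftrightarrow>
     \<phi> \<in> extensional (V 2) \<and>
     lie_module_iso sl2 vscale (V 2) (vact 2) mscale sl2 commutator \<phi> \<and>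
     \<phi> (vb 2 0) = sl2_e"

definition V2_adj_iso :: "(nat \<Rightarrow> complex) \<Rightarrow> complex^2^2" where
  "V2_adj_iso = (THE \<phi>. is_V2_adj_iso \<phi>)"

lemma is_V2_adj_iso_iff:
  "is_V2_adj_iso \<phi> \<longleftrightarrow>
     \<phi> = (\<lambda>v\<in>V 2. mscale (v 0) sl2_e + mscale (- v 1) sl2_h + mscale (-2 * v 2) sl2_f)"
    (is "_ \<longleftrightarrow> \<phi> = ?\<psi>")
proof
  have mem: "vb 2 k \<in> V 2" for k by simp
  have sub: "Vn.V.subspace (V 2)" by (rule Vn.subspace_V)
  {
    assume iso: "is_V2_adj_iso \<phi>"
    then have add: "w \<in> V 2 \<Longrightarrow> \<phi> (v + w) = \<phi> v + \<phi> w" and scale: "\<phi> (vscale c v) = mscale c (\<phi> v)"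
      and equi: "x \<in> sl2 \<Longrightarrow> \<phi> (vact 2 x v) = commutator x (\<phi> v)"
      if "v \<in> V 2" for v w c x
      using that by (auto simp: is_V2_adj_iso_def lie_module_iso_def)
    have 0: "\<phi> (vb 2 0) = sl2_e" and ext: "\<phi> \<in> extensional (V 2)"
      using iso by (auto simp: is_V2_adj_iso_def)
    have 1: "\<phi> (vb 2 1) = mscale (- 1) sl2_h"
      using equi[OF mem efh_in_sl2(3), of 0] vact_basis(3)[of 0 2] 0
      by (simp add: mat2_simps sl2_e_def sl2_f_def sl2_h_def)
    have 2: "\<phi> (vb 2 2) = mscale (- 2) sl2_f"
      using equi[OF mem efh_in_sl2(3), of 1] vact_basis(3)[of 1 2] 1
      by (simp add: mat2_simps sl2_e_def sl2_f_def sl2_h_def)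
    show "\<phi> = ?\<psi>"
    proof (rule extensionalityI[OF ext restrict_extensional])
      fix v assume v: "v \<in> V 2"
      have "v = vscale (v 0) (vb 2 0) + vscale (v 1) (vb 2 1) + vscale (v 2) (vb 2 2)"
        using V_expansion[OF v] by (simp add: numeral_2_eq_2)
      then have "\<phi> v = \<phi> (vscale (v 0) (vb 2 0) + vscale (v 1) (vb 2 1) + vscale (v 2) (vb 2 2))"
        by simp
      also have "\<dots> = mscale (v 0) sl2_e + mscale (v 1) (mscale (- 1) sl2_h) + mscale (v 2) (mscale (- 2) sl2_f)"
        using mem sub
        by (simp add: add scale Vn.V.subspace_add Vn.V.subspace_scale 0 1 2)
      finally show "\<phi> v = ?\<psi> v" using v by (simp add: mult.commute)
    qed
  }
  {
    assume eq: "\<phi> = ?\<psi>"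
    define \<psi> where "\<psi> = ?\<psi>"
    have mult: "\<psi> v $ 1 $ 1 = - v 1" "\<psi> v $ 1 $ 2 = v 0" "\<psi> v $ 2 $ 1 = - 2 * v 2"
      "\<psi> v $ 2 $ 2 = v 1" if "v \<in> V 2" for v
      using that by (simp_all add: \<psi>_def mscale_def sl2_e_def sl2_h_def sl2_f_def)
    have psi_ext: "\<psi> \<in> extensional (V 2)" by (simp add: \<psi>_def)
    have "bij_betw \<psi> (V 2) sl2"
    proof (rule bij_betwI[where g = "\<lambda>A i. if i = 0 then A $ 1 $ 2 else if i = 1 then - A $ 1 $ 1
            else if i = 2 then - A $ 2 $ 1 / 2 else 0"], goal_cases)
      case 1 then show ?case by (auto simp: sl2_iff mult)
    next
      case 2 then show ?case by (auto simp: V_def)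
    next
      case (3 v) then show ?case using mult[OF 3] by (auto simp: fun_eq_iff V_def)
    next
      case (4 A)
      have "(\<lambda>i. if i = 0 then A $ 1 $ 2 else if i = 1 then - A $ 1 $ 1
            else if i = 2 then - A $ 2 $ 1 / 2 else 0) \<in> V 2" by (auto simp: V_def)
      with 4 show ?case by (simp add: sl2_iff vec_eq_iff forall_2 mult)
    qed
    moreover have "\<psi> (v + w) = \<psi> v + \<psi> w" if "v \<in> V 2" "w \<in> V 2" for v w
      using that sub
      by (simp add: Vn.V.subspace_add vec_eq_iff forall_2 mult)
    moreover have "\<psi> (vscale c v) = mscale c (\<psi> v)" if "v \<in> V 2" for v c
    proof -
      have "vscale c v \<in> V 2" using that sub by (simp add: Vn.V.subspace_scale)
      with that show ?thesis
        by (simp add: mat2_simps mult) (simp add: vscale_def)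
    qed
    moreover have "\<psi> (vact 2 x v) = commutator x (\<psi> v)" if "v \<in> V 2" "x \<in> sl2" for x v
    proof -
      have "v 3 = 0" using that by (simp add: V_def)
      with that show ?thesis
        by (simp add: Vn.act_closed mat2_simps mult sl2_iff)
          (simp add: vact_coord algebra_simps numeral_2_eq_2 numeral_3_eq_3)
    qed
    moreover have "\<psi> (vb 2 0) = sl2_e"
      using mem[of 0] by (simp add: mult vec_eq_iff forall_2)
        (simp add: vb_def sl2_e_def)
    ultimately show "is_V2_adj_iso \<phi>"
      unfolding eq \<psi>_def[symmetric] is_V2_adj_iso_def lie_module_iso_def using psi_ext by blast
  }
qed

lemma V2_adj_iso_eq:
  "V2_adj_iso = (\<lambda>v\<in>V 2. mscale (v 0) sl2_e + mscale (- v 1) sl2_h + mscale (-2 * v 2) sl2_f)"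
  by (simp add: V2_adj_iso_def is_V2_adj_iso_iff)

lemma V2_adj_iso: "is_V2_adj_iso V2_adj_iso"
  by (simp add: V2_adj_iso_eq is_V2_adj_iso_iff)

definition Ibder :: "(complex^2^2 \<Rightarrow> complex^2^2 \<Rightarrow> (nat \<Rightarrow> complex)) set" where
  "Ibder = {g. \<exists>c. g = (\<lambda>x\<in>sl2. \<lambda>y\<in>sl2.
     inv_into (V 2) V2_adj_iso (mscale c (commutator x y)))}"

end

theory Submission
  imports Defs
begin

text \<open>For each fixed argument a biderivation \<open>g\<close> is a derivation in the other one. Let \<open>n > 0\<close>. The
  Casimir element acts on \<open>V n\<close> by the nonzero scalar \<open>n (n + 2)\<close>, and dividing by it makes every
  derivation inner, as in Whitehead's lemma: \<open>g x z = x \<cdot> \<phi> z\<close> (\<open>derivation_is_inner\<close>).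

  Dividing by the Casimir scalar a second time shows that \<open>g\<close> is skew-symmetric. If \<open>g\<close> is symmetric,
  then \<open>x \<cdot> \<phi> z = z \<cdot> \<phi> x\<close>, and summing over dual bases gives \<open>\<phi> z = z \<cdot> u\<close> for a single vector \<open>u\<close>.
  Hence \<open>x \<cdot> z \<cdot> u = z \<cdot> x \<cdot> u\<close>, that is, \<open>[x, z] \<cdot> u = 0\<close>. As \<open>sl(2)\<close> is spanned by commutators,
  \<open>sl(2) \<cdot> u = 0\<close> and \<open>g = 0\<close> (\<open>symmetric_biderivation_eq_0\<close>). The sum of any \<open>g\<close> and its flip is
  symmetric, hence zero (\<open>biderivation_skew\<close>).

  Skew-symmetry leaves very little room in \<open>V n\<close>. From \<open>e \<cdot> \<phi> e = g e e = 0\<close> it follows that \<open>\<phi> e\<close> is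
  a multiple of the highest weight vector \<open>v\<^sub>0\<close>, and \<open>\<phi> f\<close> is likewise a multiple of \<open>v\<^sub>n\<close>. So
  \<open>g f e\<close> is a multiple of \<open>v\<^sub>1\<close> and \<open>g e f\<close> a multiple of \<open>v\<^sub>n\<^sub>-\<^sub>1\<close>. These two are opposite, so both
  vanish unless \<open>n = 2\<close>. On the other hand \<open>g f e\<close> determines \<open>g\<close> (\<open>V_biderivation_eq_0I\<close>): this
  gives \<open>g = 0\<close> for \<open>n \<noteq> 2\<close>, and for \<open>n = 2\<close> the inner biderivation with the same value at
  \<open>(f, e)\<close> equals \<open>g\<close>. For \<open>n = 0\<close> the action is zero, and derivations vanish because they vanish
  on commutators.\<close>

section \<open>Derivations and biderivations with values in a module\<close>

context lie_module
begin

lemma act_add: "x \<in> L \<Longrightarrow> v \<in> V \<Longrightarrow> w \<in> V \<Longrightarrow> act x (v + w) = act x v + act x w"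
  and act_scale: "x \<in> L \<Longrightarrow> v \<in> V \<Longrightarrow> act x (scaleV c v) = scaleV c (act x v)"
  and act_add_left: "x \<in> L \<Longrightarrow> y \<in> L \<Longrightarrow> v \<in> V \<Longrightarrow> act (x + y) v = act x v + act y v"
  and act_scale_left: "x \<in> L \<Longrightarrow> v \<in> V \<Longrightarrow> act (scaleL c x) v = scaleV c (act x v)"
  using act_bilinear by (auto simp: bilinear_on_def)

lemma act_zero: "x \<in> L \<Longrightarrow> act x 0 = 0"
  using act_scale[of x 0 0] V.subspace_0[OF subspace_V] by simp

lemma act_minus: "x \<in> L \<Longrightarrow> v \<in> V \<Longrightarrow> act x (- v) = - act x v"
  using act_scale[of x v "-1"] by simp

lemma act_diff: "x \<in> L \<Longrightarrow> v \<in> V \<Longrightarrow> w \<in> V \<Longrightarrow> act x (v - w) = act x v - act x w"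
  using act_add[of x v "- w"] V.subspace_neg[OF subspace_V] by (simp add: act_minus)

lemmas V_closed = V.subspace_0[OF subspace_V] V.subspace_add[OF subspace_V]
  V.subspace_diff[OF subspace_V] V.subspace_neg[OF subspace_V] V.subspace_scale[OF subspace_V]

definition derivation :: "('a \<Rightarrow> 'v) \<Rightarrow> bool" where
  "derivation D \<longleftrightarrow> (\<forall>x\<in>L. D x \<in> V) \<and>
     (\<forall>x\<in>L. \<forall>y\<in>L. D (x + y) = D x + D y) \<and>
     (\<forall>c. \<forall>x\<in>L. D (scaleL c x) = scaleV c (D x)) \<and>
     (\<forall>x\<in>L. \<forall>y\<in>L. D (bracket x y) = act x (D y) - act y (D x))"

text \<open>Since being a biderivation is a condition on each argument separately, what is proved
  for derivations applies to both arguments, and the flip of a biderivation is a biderivation.\<close>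

definition biderivation :: "('a \<Rightarrow> 'a \<Rightarrow> 'v) \<Rightarrow> bool" where
  "biderivation g \<longleftrightarrow> (\<forall>z\<in>L. derivation (\<lambda>x. g x z)) \<and> (\<forall>x\<in>L. derivation (g x))"

lemma Bder_iff: "g \<in> Bder \<longleftrightarrow> g \<in> L \<rightarrow>\<^sub>E (L \<rightarrow>\<^sub>E V) \<and> biderivation g"
  unfolding Bder_def biderivation_def derivation_def bilinear_on_def
  by (intro iffI conjI ballI allI CollectI; elim conjE CollectE; simp add: PiE_iff)

lemma derivation_inner: "u \<in> V \<Longrightarrow> derivation (\<lambda>x. act x u)"
  by (simp add: derivation_def act_closed act_add_left act_scale_left act_bracket)

lemma derivation_add: "derivation D \<Longrightarrow> derivation D' \<Longrightarrow> derivation (\<lambda>x. D x + D' x)"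
  by (auto simp: derivation_def V_closed act_add V.scale_right_distrib)

lemma derivation_scale: "derivation D \<Longrightarrow> derivation (\<lambda>x. scaleV c (D x))"
  by (simp add: derivation_def V_closed act_scale V.scale_right_distrib
      V.scale_right_diff_distrib V.scale_left_commute)

lemma derivation_cong: "(\<And>x. x \<in> L \<Longrightarrow> D x = D' x) \<Longrightarrow> derivation D \<longleftrightarrow> derivation D'"
  by (auto simp: derivation_def bracket_closed L.subspace_add[OF subspace_L] L.subspace_scale[OF subspace_L])

lemma biderivation_flip: "biderivation g \<Longrightarrow> biderivation (\<lambda>x y. g y x)"
  by (auto simp: biderivation_def)

lemma biderivation_add:
  "biderivation g \<Longrightarrow> biderivation g' \<Longrightarrow> biderivation (\<lambda>x y. g x y + g' x y)"
  by (simp add: biderivation_def derivation_add)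

lemma biderivation_scale: "biderivation g \<Longrightarrow> biderivation (\<lambda>x y. scaleV c (g x y))"
  by (simp add: biderivation_def derivation_scale)

lemma biderivation_diff:
  "biderivation g \<Longrightarrow> biderivation g' \<Longrightarrow> biderivation (\<lambda>x y. g x y - g' x y)"
  using biderivation_add[of g "\<lambda>x y. scaleV (-1) (g' x y)"] biderivation_scale[of g' "-1"] by simp

lemma biderivation_restrict:
  "biderivation (\<lambda>x\<in>L. \<lambda>y\<in>L. g x y) \<longleftrightarrow> biderivation g"
  unfolding biderivation_def
  by (intro arg_cong2[where f = "(\<and>)"] ball_cong refl derivation_cong) auto

lemma biderivation_closed: "biderivation g \<Longrightarrow> x \<in> L \<Longrightarrow> y \<in> L \<Longrightarrow> g x y \<in> V"
  by (simp add: biderivation_def derivation_def)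

end

section \<open>Derivations and symmetric biderivations of sl(2)\<close>

lemma commutator_efh:
  "commutator sl2_e sl2_f = sl2_h"
  "commutator sl2_h sl2_e = mscale 2 sl2_e"
  "commutator sl2_f sl2_h = mscale 2 sl2_f"
  by (simp_all add: mat2_simps sl2_e_def sl2_h_def sl2_f_def)

locale sl2_module = lie_module mscale sl2 commutator scaleV V act
  for scaleV :: "complex \<Rightarrow> 'v::ab_group_add \<Rightarrow> 'v" and V act
begin

abbreviation "E \<equiv> act sl2_e"
abbreviation "H \<equiv> act sl2_h"
abbreviation "F \<equiv> act sl2_f"

text \<open>The sum \<open>\<Sum>\<^sub>i x\<^sub>i x\<^sup>i\<close> over bases that are dual for the form \<open>tr(xy) / 2\<close>: the dual basis of
  \<open>e, h, f\<close> is \<open>2f, h, 2e\<close>, so that no fractions occur.\<close>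

definition casimir :: "'v \<Rightarrow> 'v" where
  "casimir v = scaleV 2 (E (F v) + F (E v)) + H (H v)"

lemma scale_2: "scaleV 2 v = v + v"
  using V.scale_left_distrib[of 1 1 v] by simp

lemmas efh_linear = act_add act_diff act_minus act_zero act_scale act_closed V_closed

text \<open>Used as rewrite rules, these move \<open>F\<close> to the left and \<open>E\<close> to the right, which decides
  identities between words in \<open>E\<close>, \<open>H\<close>, \<open>F\<close>.\<close>

lemma efh_order:
  assumes "v \<in> V"
  shows "E (F v) = F (E v) + H v"
    and "E (H v) = H (E v) - (E v + E v)"
    and "H (F v) = F (H v) - (F v + F v)"
  using act_bracket[of sl2_e sl2_f v] act_bracket[of sl2_h sl2_e v] act_bracket[of sl2_f sl2_h v] assms
  by (simp_all add: commutator_efh act_scale_left scale_2)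

lemma derivation_efh:
  assumes "derivation D"
  shows "D sl2_h = E (D sl2_f) - F (D sl2_e)"
    and "E (D sl2_h) = H (D sl2_e) - (D sl2_e + D sl2_e)"
    and "F (D sl2_h) = H (D sl2_f) + (D sl2_f + D sl2_f)"
proof -
  have D: "D (commutator x y) = act x (D y) - act y (D x)" "D (mscale c x) = scaleV c (D x)"
    if "x \<in> sl2" "y \<in> sl2" for x y c
    using assms that by (auto simp: derivation_def)
  show "D sl2_h = E (D sl2_f) - F (D sl2_e)"
    and "E (D sl2_h) = H (D sl2_e) - (D sl2_e + D sl2_e)"
    and "F (D sl2_h) = H (D sl2_f) + (D sl2_f + D sl2_f)"
    using D(1)[of sl2_e sl2_f] D(1)[of sl2_h sl2_e] D(1)[of sl2_f sl2_h] D(2)[of sl2_e sl2_e 2] D(2)[of sl2_f sl2_e 2]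
    by (simp_all add: commutator_efh scale_2 algebra_simps)
qed

lemma derivation_eqI:
  assumes "derivation D" "derivation D'"
    and "D sl2_e = D' sl2_e" "D sl2_h = D' sl2_h" "D sl2_f = D' sl2_f"
    and "x \<in> sl2"
  shows "D x = D' x"
proof -
  have expand: "D x = scaleV (x $ 1 $ 2) (D sl2_e) + scaleV (x $ 1 $ 1) (D sl2_h) + scaleV (x $ 2 $ 1) (D sl2_f)"
    if "derivation D" for D
    using that sl2_decomp[OF \<open>x \<in> sl2\<close>]
    by (metis (no_types, lifting) derivation_def efh_in_sl2 sl2.L.subspace_add sl2.L.subspace_scale sl2.subspace_L)
  show ?thesis using expand[OF assms(1)] expand[OF assms(2)] assms(3-5) by simp
qed

end

text \<open>On a nontrivial simple module the Casimir element acts by a nonzero scalar. Dividing by this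
  scalar is how an element of the module is recovered from its images under \<open>sl(2)\<close>.\<close>

locale sl2_module_casimir = sl2_module scaleV V act
  for scaleV :: "complex \<Rightarrow> 'v::ab_group_add \<Rightarrow> 'v" and V act +
  fixes c :: complex
  assumes casimir_scalar: "v \<in> V \<Longrightarrow> casimir v = scaleV c v" and casimir_nonzero: "c \<noteq> 0"
begin

lemma casimir_divide:
  assumes "v \<in> V" "w \<in> V" "x \<in> sl2" "act x w = casimir v"
  shows "v = act x (scaleV (1 / c) w)"
  using assms casimir_nonzero by (simp add: act_scale casimir_scalar)

text \<open>For dual bases \<open>x\<^sub>i\<close> and \<open>x\<^sup>i\<close> as in the Casimir element, the vector \<open>w = \<Sum>\<^sub>i x\<^sub>i \<cdot> D x\<^sup>i\<close> satisfies
  \<open>x \<cdot> w = \<Sum>\<^sub>i ([x, x\<^sub>i] \<cdot> D x\<^sup>i + x\<^sub>i \<cdot> D [x, x\<^sup>i]) + casimir (D x)\<close>, and the first sum vanishes by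
  invariance of \<open>\<Sum>\<^sub>i x\<^sub>i \<otimes> x\<^sup>i\<close>. So \<open>D\<close> is the inner derivation given by \<open>w\<close> divided by the scalar.
  The proof carries this out on \<open>e\<close>, \<open>h\<close>, \<open>f\<close>.\<close>

lemma derivation_is_inner:
  assumes D: "derivation D"
  obtains u where "u \<in> V" "\<And>x. x \<in> sl2 \<Longrightarrow> D x = act x u"
proof -
  define w where "w = scaleV 2 (E (D sl2_f) + F (D sl2_e)) + H (D sl2_h)"
  have V: "D sl2_e \<in> V" "D sl2_h \<in> V" "D sl2_f \<in> V"
    using D by (simp_all add: derivation_def)
  note efh = derivation_efh[OF D]
  have w: "w \<in> V" using V by (simp add: w_def efh_linear)
  have EE: "E (E (D sl2_f)) = F (E (D sl2_e)) + H (D sl2_e) + E (D sl2_h)"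
    using V by (simp add: efh(1) efh_linear efh_order)
  have FF: "F (F (D sl2_e)) = F (E (D sl2_f)) - F (D sl2_h)"
    using V by (simp add: efh(1) efh_linear)
  have "E w = casimir (D sl2_e)"
    using V by (simp add: w_def casimir_def scale_2 efh_linear efh_order efh(2) EE)
  moreover have "F w = casimir (D sl2_f)"
  proof -
    have *: "F (H (D sl2_h)) = H (F (D sl2_h)) + (F (D sl2_h) + F (D sl2_h))"
      using V by (simp add: efh_order)
    show ?thesis
      using V by (simp add: w_def casimir_def scale_2 efh_linear efh_order(1,3) efh(3) FF *)
  qed
  moreover have "H w = casimir (D sl2_h)"
  proof -
    have *: "casimir (D sl2_h) = H (H (D sl2_h)) + scaleV 2 (E (F (D sl2_h)) + F (E (D sl2_h)))"
      by (simp add: casimir_def)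
    have "H (E (D sl2_f)) + H (F (D sl2_e)) = E (F (D sl2_h)) + F (E (D sl2_h))"
      using V by (simp add: efh_linear efh_order efh(2,3))
    then show ?thesis
      using V by (simp add: * w_def efh_linear)
  qed
  moreover define u where "u = scaleV (1 / c) w"
  ultimately have u: "u \<in> V" "D sl2_e = E u" "D sl2_h = H u" "D sl2_f = F u"
    using casimir_divide[OF V(1) w] casimir_divide[OF V(2) w] casimir_divide[OF V(3) w] w
    by (simp_all add: V_closed)
  then show ?thesis
    using derivation_eqI[OF D derivation_inner[OF u(1)]] that by blast
qed

lemma biderivation_eq_0I:
  assumes g: "biderivation g"
    and "\<And>x. x \<in> sl2 \<Longrightarrow> g x sl2_e = 0" "\<And>x. x \<in> sl2 \<Longrightarrow> g x sl2_h = 0"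
      "\<And>x. x \<in> sl2 \<Longrightarrow> g x sl2_f = 0"
    and "x \<in> sl2" "y \<in> sl2"
  shows "g x y = 0"
proof -
  have "derivation (g x)"
    using g \<open>x \<in> sl2\<close> by (simp add: biderivation_def)
  from derivation_eqI[OF this derivation_scale[OF this, of 0]] show ?thesis
    using assms by simp
qed

text \<open>Here \<open>p\<close>, \<open>q\<close>, \<open>r\<close> are the values at \<open>e\<close>, \<open>h\<close>, \<open>f\<close> of a map \<open>\<phi>\<close> with \<open>x \<cdot> \<phi> z = z \<cdot> \<phi> x\<close>, and
  \<open>w = \<Sum>\<^sub>i x\<^sub>i \<cdot> \<phi> x\<^sup>i\<close>. Then \<open>\<Sum>\<^sub>i x\<^sub>i \<cdot> x\<^sup>i \<cdot> \<phi> z = \<Sum>\<^sub>i x\<^sub>i \<cdot> z \<cdot> \<phi> x\<^sup>i = z \<cdot> w + \<Sum>\<^sub>i [x\<^sub>i, z] \<cdot> \<phi> x\<^sup>i\<close>.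
  The last sum equals \<open>\<Sum>\<^sub>i x\<^sup>i \<cdot> \<phi> [x\<^sub>i, z]\<close> by symmetry and the negative of this by invariance, so it is
  zero and \<open>\<phi> z\<close> is \<open>z \<cdot> w\<close> divided by the Casimir scalar.\<close>

lemma symmetric_biderivation_eq_0:
  assumes g: "biderivation g"
    and sym: "\<And>x y. x \<in> sl2 \<Longrightarrow> y \<in> sl2 \<Longrightarrow> g x y = g y x"
    and "x \<in> sl2" "y \<in> sl2"
  shows "g x y = 0"
proof -
  have der: "derivation (\<lambda>x. g x z)" if "z \<in> sl2" for z
    using g that by (simp add: biderivation_def)
  obtain p where p: "p \<in> V" "\<And>x. x \<in> sl2 \<Longrightarrow> g x sl2_e = act x p"
    using derivation_is_inner[OF der[of sl2_e]] by auto
  obtain q where q: "q \<in> V" "\<And>x. x \<in> sl2 \<Longrightarrow> g x sl2_h = act x q"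
    using derivation_is_inner[OF der[of sl2_h]] by auto
  obtain r where r: "r \<in> V" "\<And>x. x \<in> sl2 \<Longrightarrow> g x sl2_f = act x r"
    using derivation_is_inner[OF der[of sl2_f]] by auto
  have cross: "E q = H p" "E r = F p" "F q = H r"
    using sym p(2) q(2) r(2) by (metis efh_in_sl2)+
  define w where "w = scaleV 2 (E r + F p) + H q"
  have w: "w \<in> V" using p q r by (simp add: w_def efh_linear)
  have "E w = casimir p"
    using p q r by (simp add: w_def casimir_def scale_2 efh_linear efh_order cross)
  moreover have "F w = casimir r"
  proof -
    have "F (H q) = H (F q) + (F q + F q)" using q by (simp add: efh_order)
    moreover have "w = scaleV 2 (E r + E r) + H q" by (simp add: w_def cross)
    ultimately show ?thesis
      using p q r by (simp add: casimir_def scale_2 efh_linear efh_order(1) cross)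
  qed
  moreover have "H w = casimir q"
  proof -
    have "F (H p) = H (F p) + (F p + F p)" "E (H r) = H (E r) - (E r + E r)"
      using p r by (simp_all add: efh_order)
    then show ?thesis
      using p q r by (simp add: w_def casimir_def scale_2 efh_linear cross)
  qed
  moreover define u where "u = scaleV (1 / c) w"
  ultimately have u: "u \<in> V" "p = E u" "q = H u" "r = F u"
    using casimir_divide[OF p(1) w] casimir_divide[OF q(1) w] casimir_divide[OF r(1) w] w
    by (simp_all add: V_closed)
  have two: "v + v = 0 \<longleftrightarrow> v = 0" for v :: 'v
    by (metis scale_2 V.scale_eq_0_iff zero_neq_numeral)
  have neg: "- v = v \<longleftrightarrow> v = 0" for v :: 'v
    using two[of v] eq_neg_iff_add_eq_0[of v v] by auto
  \<comment> \<open>With \<open>p\<close>, \<open>q\<close>, \<open>r\<close> expressed through \<open>u\<close>, the cross relations say that commutators kill \<open>u\<close>.\<close>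
  have "q = 0" "p = 0" "r = 0"
    using cross u(1) unfolding u(2-4) by (simp_all add: efh_order neg)
  with p q r show ?thesis
    by (intro biderivation_eq_0I[OF g _ _ _ assms(3,4)]) (simp_all add: act_zero)
qed

lemma biderivation_skew:
  assumes g: "biderivation g" and "x \<in> sl2" "y \<in> sl2"
  shows "g x y = - g y x"
proof -
  have "g x y + g y x = 0"
    by (rule symmetric_biderivation_eq_0[OF biderivation_add[OF g biderivation_flip[OF g]]])
      (simp_all only: add.commute assms)
  then show ?thesis
    by (simp only: eq_neg_iff_add_eq_0)
qed

end

section \<open>Biderivations with values in V(n)\<close>

lemma vact_efh_coord:
  assumes "v \<in> V n"
  shows "vact n sl2_e v j = (if j \<le> n then of_nat (j + 1) * (of_nat n - of_nat j) * v (j + 1) else 0)"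
    and "vact n sl2_h v j = (if j \<le> n then (of_nat n - 2 * of_nat j) * v j else 0)"
    and "vact n sl2_f v j = (if 0 < j \<and> j \<le> n then v (j - 1) else 0)"
  by (simp_all add: vact_coord[OF assms] sl2_e_def sl2_h_def sl2_f_def)

lemma V_sl2_module_casimir:
  assumes "0 < n"
  shows "sl2_module_casimir vscale (V n) (vact n) (of_nat (n * (n + 2)))"
proof -
  interpret sl2_module vscale "V n" "vact n" by unfold_locales
  show ?thesis
  proof
    fix v assume v: "v \<in> V n"
    show "casimir v = vscale (of_nat (n * (n + 2))) v"
    proof
      fix j
      show "casimir v j = vscale (of_nat (n * (n + 2))) v j"
      proof (cases "j \<le> n")
        case False
        then show ?thesis using v
          by (simp add: casimir_def vscale_def vact_efh_coord Vn.act_closed V_def[of n])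
      next
        case True
        have ef: "vact n sl2_e (vact n sl2_f v) j = (of_nat j + 1) * (of_nat n - of_nat j) * v j"
          using v True by (cases "j = n") (simp_all add: vact_efh_coord Vn.act_closed)
        have fe: "vact n sl2_f (vact n sl2_e v) j = of_nat j * (of_nat n - of_nat j + 1) * v j"
          using v True by (cases j) (simp_all add: vact_efh_coord Vn.act_closed)
        have hh: "vact n sl2_h (vact n sl2_h v) j = (of_nat n - 2 * of_nat j)^2 * v j"
          using v True by (simp add: vact_efh_coord Vn.act_closed power2_eq_square)
        show ?thesis
          unfolding casimir_def
          by (simp add: vscale_def ef fe hh power2_eq_square algebra_simps)
      qed
    qed
  next
    show "of_nat (n * (n + 2)) \<noteq> (0 :: complex)"
      using assms by (simp only: of_nat_eq_0_iff) simp
  qed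
qed

lemma highest_weight_vector:
  assumes "v \<in> V n" "vact n sl2_e v = 0"
  shows "v = vscale (v 0) (vb n 0)"
proof
  fix j
  have "v (Suc k) = 0" if "k < n" for k
    using fun_cong[OF assms(2), of k] that
    by (simp add: vact_efh_coord assms(1) del: of_nat_Suc)
  then show "v j = vscale (v 0) (vb n 0) j"
    using assms(1) by (cases j; cases "j \<le> n") (auto simp: V_def vscale_def vb_def)
qed

lemma lowest_weight_vector:
  assumes "v \<in> V n" "vact n sl2_f v = 0"
  shows "v = vscale (v n) (vb n (int n))"
proof
  fix j
  have "v k = 0" if "k < n" for k
    using fun_cong[OF assms(2), of "Suc k"] that by (simp add: vact_efh_coord assms(1))
  then show "v j = vscale (v n) (vb n (int n)) j"
    using assms(1) by (cases "j < n") (auto simp: V_def vscale_def vb_def)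
qed

text \<open>Skew-symmetry gives \<open>g e e = 0\<close> and \<open>g f f = 0\<close>, so the vectors that represent \<open>g _ e\<close> and
  \<open>g _ f\<close> are killed by \<open>e\<close> and \<open>f\<close>, respectively.\<close>

lemma V_biderivation_extremal:
  assumes "0 < n" and g: "Vn.biderivation n g"
  obtains a b where "\<And>x. x \<in> sl2 \<Longrightarrow> g x sl2_e = vact n x (vscale a (vb n 0))"
    and "\<And>x. x \<in> sl2 \<Longrightarrow> g x sl2_f = vact n x (vscale b (vb n (int n)))"
    and "g sl2_f sl2_e = vscale a (vb n 1)"
    and "g sl2_e sl2_f = vscale (b * of_nat n) (vb n (int n - 1))"
proof -
  interpret sl2_module_casimir vscale "V n" "vact n" "of_nat (n * (n + 2))"
    by (rule V_sl2_module_casimir[OF \<open>0 < n\<close>])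
  have der: "Vn.derivation n (\<lambda>x. g x z)" if "z \<in> sl2" for z
    using g that by (simp add: Vn.biderivation_def)
  have diag: "g x x = 0" if "x \<in> sl2" for x
    using biderivation_skew[OF g that that] by (auto simp: fun_eq_iff)
  obtain p where p: "p \<in> V n" "\<And>x. x \<in> sl2 \<Longrightarrow> g x sl2_e = vact n x p"
    using derivation_is_inner[OF der[of sl2_e]] by auto
  obtain r where r: "r \<in> V n" "\<And>x. x \<in> sl2 \<Longrightarrow> g x sl2_f = vact n x r"
    using derivation_is_inner[OF der[of sl2_f]] by auto
  have "p = vscale (p 0) (vb n 0)" "r = vscale (r n) (vb n (int n))"
    using highest_weight_vector[OF p(1)] lowest_weight_vector[OF r(1)]
      p(2)[of sl2_e] r(2)[of sl2_f] diag by simp_all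
  then have p': "\<And>x. x \<in> sl2 \<Longrightarrow> g x sl2_e = vact n x (vscale (p 0) (vb n 0))"
    and r': "\<And>x. x \<in> sl2 \<Longrightarrow> g x sl2_f = vact n x (vscale (r n) (vb n (int n)))"
    using p(2) r(2) by simp_all
  from p' r' show ?thesis
    using vact_basis(3)[of 0 n] vact_basis(1)[of n n]
    by (intro that[OF p' r']) (simp_all add: Vn.act_scale)
qed

text \<open>Since \<open>f \<cdot> v\<^sub>0 = v\<^sub>1\<close> and \<open>e \<cdot> v\<^sub>n = n v\<^sub>n\<^sub>-\<^sub>1\<close> are nonzero, the hypothesis and skew-symmetry kill both multiples
  in the preceding lemma, hence \<open>g _ e\<close> and \<open>g _ f\<close>. By skew-symmetry \<open>g _ h\<close> is then a derivation that
  vanishes on the basis.\<close>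

lemma V_biderivation_eq_0I:
  assumes "0 < n" and g: "Vn.biderivation n g" and "g sl2_f sl2_e = 0"
    and xy: "x \<in> sl2" "y \<in> sl2"
  shows "g x y = 0"
proof -
  interpret sl2_module_casimir vscale "V n" "vact n" "of_nat (n * (n + 2))"
    by (rule V_sl2_module_casimir[OF \<open>0 < n\<close>])
  obtain a b where a: "\<And>x. x \<in> sl2 \<Longrightarrow> g x sl2_e = vact n x (vscale a (vb n 0))"
    and b: "\<And>x. x \<in> sl2 \<Longrightarrow> g x sl2_f = vact n x (vscale b (vb n (int n)))"
    and ab: "g sl2_f sl2_e = vscale a (vb n 1)"
      "g sl2_e sl2_f = vscale (b * of_nat n) (vb n (int n - 1))"
    using V_biderivation_extremal[OF assms(1,2)] by metis
  have skew: "g x y = - g y x" if "x \<in> sl2" "y \<in> sl2" for x y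
    using biderivation_skew[OF g that] .
  have "a = 0"
    using assms(1,3) fun_cong[OF ab(1), of 1] by (simp add: vscale_def vb_def)
  moreover have "b = 0"
    using assms(1,3) fun_cong[OF ab(2), of "n - 1"] skew[of sl2_e sl2_f]
    by (simp add: vscale_def vb_def)
  ultimately have e0: "g x sl2_e = 0" and f0: "g x sl2_f = 0" if "x \<in> sl2" for x
    using a b that by (simp_all add: Vn.act_zero)
  have "Vn.derivation n (\<lambda>x. g x sl2_h)"
    using g by (simp add: Vn.biderivation_def)
  note h = derivation_eqI[OF this Vn.derivation_scale[OF this, of 0]]
  have "g sl2_e sl2_h = 0" "g sl2_h sl2_h = 0" "g sl2_f sl2_h = 0"
    using skew[of sl2_e sl2_h] skew[of sl2_h sl2_h] skew[of sl2_f sl2_h] e0[of sl2_h] f0[of sl2_h]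
    by (auto simp: fun_eq_iff)
  then have h0: "g x sl2_h = 0" if "x \<in> sl2" for x
    using h that by simp
  show ?thesis
    by (rule biderivation_eq_0I[OF g e0 h0 f0 xy])
qed

lemma V_biderivation_eq_0:
  assumes "n \<noteq> 2" "Vn.biderivation n g" "x \<in> sl2" "y \<in> sl2"
  shows "g x y = 0"
proof (cases "n = 0")
  case True
  interpret sl2_module vscale "V n" "vact n" by unfold_locales
  have der: "Vn.derivation n (\<lambda>x. g x y)"
    using assms by (simp add: Vn.biderivation_def)
  have D: "D x = 0" if D: "Vn.derivation n D" for D
  proof -
    have triv: "vact n x v = 0" if "v \<in> V n" for x v
      using that True by (auto simp: fun_eq_iff vact_coord)
    have "D sl2_e \<in> V n" "D sl2_h \<in> V n" "D sl2_f \<in> V n"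
      using D by (simp_all add: Vn.derivation_def)
    then have "D sl2_h = 0" "D sl2_e + D sl2_e = 0" "D sl2_f + D sl2_f = 0"
      using derivation_efh[OF D] by (simp_all add: triv)
    then have "D sl2_h = 0" "D sl2_e = 0" "D sl2_f = 0"
      by (auto simp: fun_eq_iff)
    then show ?thesis
      using derivation_eqI[OF D Vn.derivation_scale[OF D, of 0]] assms by simp
  qed
  from D[OF der] show ?thesis .
next
  case False
  interpret sl2_module_casimir vscale "V n" "vact n" "of_nat (n * (n + 2))"
    using False by (intro V_sl2_module_casimir) simp
  obtain a b where a: "g sl2_f sl2_e = vscale a (vb n 1)"
      and b: "g sl2_e sl2_f = vscale (b * of_nat n) (vb n (int n - 1))"
    using V_biderivation_extremal[of n g] False assms by (metis gr0I)
  have "g sl2_f sl2_e = - g sl2_e sl2_f"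
    using assms by (intro biderivation_skew) simp_all
  \<comment> \<open>For \<open>n \<noteq> 2\<close> the vectors \<open>v\<^sub>1\<close> and \<open>v\<^sub>n\<^sub>-\<^sub>1\<close> are different, so the coordinate at 1 isolates \<open>a\<close>.\<close>
  then have "vscale a (vb n 1) 1 = - vscale (b * of_nat n) (vb n (int n - 1)) 1"
    by (simp add: a b)
  then have "a = 0"
    using assms False by (auto simp: vscale_def vb_def split: if_splits)
  then have "g sl2_f sl2_e = 0"
    by (simp add: a)
  then show ?thesis
    using False assms by (intro V_biderivation_eq_0I[of n g x y, OF _ assms(2) _ assms(3,4)]) simp_all
qed

section \<open>Inner biderivations\<close>

lemma adj_biderivation_commutator: "adj.biderivation commutator"
proof -
  have "adj.derivation (commutator x)" if "x \<in> sl2" for x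
  proof -
    \<comment> \<open>In its second argument the commutator is the inner derivation given by \<open>- x\<close>.\<close>
    have "commutator x = (\<lambda>y. mscale (-1) (commutator y x))"
      by (simp add: fun_eq_iff commutator_def)
    then show ?thesis
      by (rule ssubst) (rule adj.derivation_scale[OF adj.derivation_inner[OF that]])
  qed
  then show ?thesis
    by (simp add: adj.biderivation_def adj.derivation_inner)
qed

text \<open>The definition of inner biderivations applies the inverse of the isomorphism, so biderivations are
  pulled back along a module isomorphism.\<close>

lemma biderivation_transport:
  assumes M: "lie_module sM L b sU U actU" and N: "lie_module sM L b sW W actW"
    and iso: "lie_module_iso L sU U actU sW W actW \<phi>"
    and g: "lie_module.biderivation sM L b sW W actW g"
  shows "lie_module.biderivation sM L b sU U actU (\<lambda>x y. inv_into U \<phi> (g x y))"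
proof -
  interpret M: lie_module sM L b sU U actU by fact
  interpret N: lie_module sM L b sW W actW by fact
  have bij: "bij_betw \<phi> U W"
    and hom: "\<And>v w. v \<in> U \<Longrightarrow> w \<in> U \<Longrightarrow> \<phi> (v + w) = \<phi> v + \<phi> w"
      "\<And>c v. v \<in> U \<Longrightarrow> \<phi> (sU c v) = sW c (\<phi> v)"
      "\<And>x v. x \<in> L \<Longrightarrow> v \<in> U \<Longrightarrow> \<phi> (actU x v) = actW x (\<phi> v)"
    using iso by (auto simp: lie_module_iso_def)
  let ?inv = "inv_into U \<phi>"
  have mem: "?inv w \<in> U" and inv: "\<phi> (?inv w) = w" if "w \<in> W" for w
    using that bij by (metis bij_betw_def inv_into_into, metis bij_betw_inv_into_right)
  have eqI: "?inv w = v" if "v \<in> U" "\<phi> v = w" for v w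
    using that bij by (metis bij_betw_inv_into_left)
  have diff: "\<phi> (v - w) = \<phi> v - \<phi> w" if "v \<in> U" "w \<in> U" for v w
    using hom(1)[of "v - w" w] that by (simp add: M.V_closed algebra_simps)
  have "M.derivation (\<lambda>x. ?inv (D x))" if "N.derivation D" for D
  proof -
    have D: "D x \<in> W" if "x \<in> L" for x
      using \<open>N.derivation D\<close> that by (simp add: N.derivation_def)
    show ?thesis
      using that unfolding M.derivation_def N.derivation_def
      by (intro conjI ballI allI eqI; simp add: D mem inv hom diff M.V_closed M.act_closed)
  qed
  with g show ?thesis
    by (simp add: M.biderivation_def N.biderivation_def)
qed

lemma V2_inner_biderivation:
  "Vn.biderivation 2 (\<lambda>x y. inv_into (V 2) V2_adj_iso (mscale c (commutator x y)))"
proof (rule biderivation_transport[OF Vn.lie_module_axioms adj.lie_module_axioms])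
  show "lie_module_iso sl2 vscale (V 2) (vact 2) mscale sl2 commutator V2_adj_iso"
    using V2_adj_iso by (simp add: is_V2_adj_iso_def)
  show "adj.biderivation (\<lambda>x y. mscale c (commutator x y))"
    by (rule adj.biderivation_scale[OF adj_biderivation_commutator])
qed

lemma V2_inner_at_fe:
  "inv_into (V 2) V2_adj_iso (mscale c (commutator sl2_f sl2_e)) = vscale c (vb 2 1)"
proof (rule inv_into_f_eq)
  show "inj_on V2_adj_iso (V 2)"
    using V2_adj_iso by (simp add: is_V2_adj_iso_def lie_module_iso_def bij_betw_def)
  show mem: "vscale c (vb 2 1) \<in> V 2"
    by (simp add: Vn.V_closed)
  show "V2_adj_iso (vscale c (vb 2 1)) = mscale c (commutator sl2_f sl2_e)"
    using mem by (simp add: V2_adj_iso_eq mat2_simps sl2_e_def sl2_f_def sl2_h_def)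
      (simp add: vscale_def vb_def)
qed

theorem theorem1p2:
  fixes n :: nat
  shows "Vn.Bder n = (if n = 2 then Ibder else {\<lambda>x\<in>sl2. \<lambda>y\<in>sl2. 0})"
proof (rule set_eqI)
  fix g :: "complex^2^2 \<Rightarrow> complex^2^2 \<Rightarrow> nat \<Rightarrow> complex"
  have eqI: "g = (\<lambda>x\<in>sl2. \<lambda>y\<in>sl2. g' x y)"
    if "g \<in> Vn.Bder n" "\<And>x y. x \<in> sl2 \<Longrightarrow> y \<in> sl2 \<Longrightarrow> g x y = g' x y" for g'
  proof -
    have "g \<in> extensional sl2" "\<And>x. x \<in> sl2 \<Longrightarrow> g x \<in> extensional sl2"
      using that(1) by (auto simp: Vn.Bder_iff PiE_iff)
    then show ?thesis
      using that(2) by (intro extensionalityI[of _ sl2]) (auto intro!: extensionalityI[of _ sl2])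
  qed
  have restrictI: "(\<lambda>x\<in>sl2. \<lambda>y\<in>sl2. g' x y) \<in> Vn.Bder n" if "Vn.biderivation n g'" for g'
    using that Vn.biderivation_closed[OF that]
    by (auto simp: Vn.Bder_iff Vn.biderivation_restrict)
  show "g \<in> Vn.Bder n \<longleftrightarrow> g \<in> (if n = 2 then Ibder else {\<lambda>x\<in>sl2. \<lambda>y\<in>sl2. 0})"
  proof (cases "n = 2")
    case True
    let ?inner = "\<lambda>c x y. inv_into (V 2) V2_adj_iso (mscale c (commutator x y))"
    have "\<exists>c. g = (\<lambda>x\<in>sl2. \<lambda>y\<in>sl2. ?inner c x y)" if g: "g \<in> Vn.Bder n"
    proof -
      have bider: "Vn.biderivation 2 g" using g True by (simp add: Vn.Bder_iff)
      obtain c where c: "g sl2_f sl2_e = vscale c (vb 2 1)"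
        using V_biderivation_extremal[OF _ bider] by (metis zero_less_numeral)
      have "g x y - ?inner c x y = 0" if "x \<in> sl2" "y \<in> sl2" for x y
      proof (rule V_biderivation_eq_0I[OF _ Vn.biderivation_diff[OF bider V2_inner_biderivation]])
        show "g sl2_f sl2_e - ?inner c sl2_f sl2_e = 0"
          by (simp only: c V2_inner_at_fe diff_self)
      qed (use that in simp_all)
      then have "g = (\<lambda>x\<in>sl2. \<lambda>y\<in>sl2. ?inner c x y)"
        by (intro eqI g) simp_all
      then show ?thesis ..
    qed
    moreover have "(\<lambda>x\<in>sl2. \<lambda>y\<in>sl2. ?inner c x y) \<in> Vn.Bder n" for c
      using V2_inner_biderivation[of c] unfolding True[symmetric]
      by (intro restrictI) (simp add: True)
    ultimately show ?thesis
      unfolding Ibder_def using True by auto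
  next
    case False
    have "Vn.biderivation n (\<lambda>_ _. 0)"
      by (auto simp: Vn.biderivation_def Vn.derivation_def Vn.V_closed Vn.act_zero)
    then have "(\<lambda>x\<in>sl2. \<lambda>y\<in>sl2. 0) \<in> Vn.Bder n"
      by (rule restrictI)
    moreover have "g = (\<lambda>x\<in>sl2. \<lambda>y\<in>sl2. 0)" if g: "g \<in> Vn.Bder n"
    proof (rule eqI[OF g])
      have "Vn.biderivation n g"
        using g by (simp add: Vn.Bder_iff)
      from V_biderivation_eq_0[OF False this]
      show "g x y = 0" if "x \<in> sl2" "y \<in> sl2" for x y
        using that by blast
    qed
    ultimately show ?thesis
      using False by auto
  qed
qed

end
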